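(* Let $0<\alpha<1$ and $T>0$. Let $k\in\{0,1\}$ and $0\le\beta\le 1$ satisfy $k+\beta>\alpha$, and let $y\in C^{k,\beta}[0,T]$. Let $\tau>0$ and $t_n=n\tau$. Then for every integer $n\ge 1$ with $t_n\in(0,T]$, the truncation error of the L1 discretization satisfies $$|D^\alpha y(t_n)-\delta^\alpha_\tau y(t_n)|\le C_{\alpha,\beta,k,n}\,[y^{(k)}]_{C^{0,\beta}[0,t_n]}\,\tau^{k+\beta-\alpha},$$ where $$C_{\alpha,\beta,k,n}=\begin{cases}\dfrac{1-n^{-\alpha}}{2^\beta\,\Gamma(1-\alpha)}+\dfrac{\alpha}{\Gamma(1-\alpha)(\beta-\alpha)(1+\beta-\alpha)}+\dfrac{\alpha\,\Gamma(1+\beta)}{\Gamma(2+\beta-\alpha)}, & k=0,\\[3mm] \dfrac{1-n^{-\alpha}}{4(\beta+1)\,\Gamma(1-\alpha)}+\dfrac{\alpha}{\Gamma(3-\alpha)}, & k=1.\end{cases}$$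
   Context: Functions are real-valued and $\Gamma$ is the Euler gamma function. Hölder spaces: for $b>0$, $k\in\{0,1\}$ and $0\le\beta\le1$, the Hölder seminorm of a function $z$ on $[0,b]$ is $$[z]_{C^{0,\beta}[0,b]}:=\sup_{t\ne\tilde t,\ t,\tilde t\in[0,b]}\frac{|z(t)-z(\tilde t)|}{|t-\tilde t|^\beta},$$ and $C^{k,\beta}[0,b]:=\{y\in C^k[0,b]:\ [y^{(k)}]_{C^{0,\beta}[0,b]}<\infty\}$, where $y^{(0)}=y$ and $y^{(1)}=y'$. For $\beta=0$ the same formula is used, so that $[z]_{C^{0,0}[0,b]}=\sup_{t\neq\tilde t}|z(t)-z(\tilde t)|$ and $C^{k,0}[0,b]=C^k[0,b]$. Caputo derivative of order $\alpha\in(0,1)$: for $t\in(0,T]$, $$D^\alpha y(t)=\frac{1}{\Gamma(1-\alpha)}\frac{y(t)-y(0)}{t^\alpha}+\frac{\alpha}{\Gamma(1-\alpha)}\int_0^t\frac{y(t)-y(s)}{(t-s)^{1+\alpha}}\,ds.$$ For sufficiently smooth $y$ this equals $\frac{1}{\Gamma(1-\alpha)}\int_0^t\frac{y'(s)}{(t-s)^\alpha}\,ds$. The first formula makes sense for every $y\in C^{0,\beta}[0,T]$ with $\beta>\alpha$. L1 discretization: on the grid $t_i=i\tau$ ($i=0,1,2,\dots$) with step $\tau>0$, for $n\ge1$ with $t_n\le T$, $$\delta^\alpha_\tau y(t_n):=\frac{\tau^{-\alpha}}{\Gamma(2-\alpha)}\left(y(t_n)-b_{n-1}\,y(0)-\sum_{i=1}^{n-1}\left(b_{n-i-1}-b_{n-i}\right)y(t_i)\right),\qquad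 b_i=(i+1)^{1-\alpha}-i^{1-\alpha},$$ where the sum is empty when $n=1$. *)

theory Defs
  imports "HOL-Analysis.Analysis"
begin

text \<open>
  Derivatives on \<open>{0..b}\<close> are taken relative to the interval, hence one-sided at its end points;
  nothing is assumed about the function outside the interval.
\<close>

primrec iter_deriv_on :: "nat \<Rightarrow> real \<Rightarrow> (real \<Rightarrow> real) \<Rightarrow> real \<Rightarrow> real" where
  "iter_deriv_on 0 b y = y"
| "iter_deriv_on (Suc k) b y = (\<lambda>t. vector_derivative (iter_deriv_on k b y) (at t within {0..b}))"

definition Ck_space :: "nat \<Rightarrow> real \<Rightarrow> (real \<Rightarrow> real) set" where
  "Ck_space k b = {y. (\<forall>j<k. iter_deriv_on j b y differentiable_on {0..b}) \<and>
                      continuous_on {0..b} (iter_deriv_on k b y)}"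

text \<open>
  The seminorm is extended real valued, so that it is a genuine supremum also for functions that
  are not Hoelder continuous. As the points are distinct, the denominator is 1 for \<open>\<beta> = 0\<close>.
\<close>

definition holder_seminorm :: "real \<Rightarrow> real \<Rightarrow> (real \<Rightarrow> real) \<Rightarrow> ereal" where
  "holder_seminorm \<beta> b z =
     (SUP (t, t') \<in> {(t, t'). t \<in> {0..b} \<and> t' \<in> {0..b} \<and> t \<noteq> t'}.
        ereal (\<bar>z t - z t'\<bar> / \<bar>t - t'\<bar> powr \<beta>))"

definition holder_space :: "nat \<Rightarrow> real \<Rightarrow> real \<Rightarrow> (real \<Rightarrow> real) set" where
  "holder_space k \<beta> b = {y \<in> Ck_space k b. holder_seminorm \<beta> b (iter_deriv_on k b y) < \<infinity>}"

text \<open>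
  The integrand is singular at \<open>s = t\<close>, where division by zero gives it the value 0.
\<close>

definition caputo :: "real \<Rightarrow> (real \<Rightarrow> real) \<Rightarrow> real \<Rightarrow> real" where
  "caputo \<alpha> y t =
     1 / Gamma (1 - \<alpha>) * ((y t - y 0) / t powr \<alpha>) +
     \<alpha> / Gamma (1 - \<alpha>) * integral {0..t} (\<lambda>s. (y t - y s) / (t - s) powr (1 + \<alpha>))"

definition l1_weight :: "real \<Rightarrow> nat \<Rightarrow> real" where
  "l1_weight \<alpha> i = (real i + 1) powr (1 - \<alpha>) - real i powr (1 - \<alpha>)"

definition l1_caputo :: "real \<Rightarrow> real \<Rightarrow> (real \<Rightarrow> real) \<Rightarrow> nat \<Rightarrow> real" where
  "l1_caputo \<alpha> \<tau> y n =
     \<tau> powr (- \<alpha>) / Gamma (2 - \<alpha>) *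
       (y (real n * \<tau>) - l1_weight \<alpha> (n - 1) * y 0
        - (\<Sum>i = 1..n - 1. (l1_weight \<alpha> (n - i - 1) - l1_weight \<alpha> (n - i)) * y (real i * \<tau>)))"

definition l1_error_const :: "real \<Rightarrow> real \<Rightarrow> nat \<Rightarrow> nat \<Rightarrow> real" where
  "l1_error_const \<alpha> \<beta> k n =
     (if k = 0 then
        (1 - real n powr (- \<alpha>)) / (2 powr \<beta> * Gamma (1 - \<alpha>))
        + \<alpha> / (Gamma (1 - \<alpha>) * (\<beta> - \<alpha>) * (1 + \<beta> - \<alpha>))
        + \<alpha> * Gamma (1 + \<beta>) / Gamma (2 + \<beta> - \<alpha>)
      else
        (1 - real n powr (- \<alpha>)) / (4 * (\<beta> + 1) * Gamma (1 - \<alpha>))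
        + \<alpha> / Gamma (3 - \<alpha>))"

end

theory Submission
  imports Defs
begin

text \<open>
  The L1 scheme is the Caputo derivative of the piecewise linear interpolant. The interpolation
  error \<open>e\<close> vanishes at the grid points, so the truncation error at \<open>t\<close> equals
  \<open>- \<alpha> / \<Gamma>(1 - \<alpha>)\<close> times the integral of \<open>e s * (t - s) powr (- 1 - \<alpha>)\<close> over \<open>{0..t}\<close>. On all cells
  but the last, \<open>e\<close> is bounded by its maximum over a cell, which gives the term with
  \<open>1 - n powr (- \<alpha>)\<close>. On the last cell the pointwise bound for \<open>e\<close> in the rescaled distance
  \<open>x = (t - s) / \<tau>\<close> turns the integral into Beta integrals.
\<close>

section \<open>Gamma recurrence and inequalities for powers\<close>

lemma Gamma_pos_plus1: "Gamma (x + 1) = x * Gamma x" if "x > 0" for x :: real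
  using that by (intro Gamma_plus1) (auto elim!: nonpos_Ints_cases)

lemma powr_neg_minus_1: "x powr (- a - 1) = 1 / x powr (1 + a)" for x a :: real
proof -
  have "- a - 1 = - (1 + a)"
    by simp
  then show ?thesis
    by (simp only: powr_minus_divide)
qed

text \<open>Concavity in the form of weighted AM-GM, applied to \<open>u\<close> and 1 with weights
  \<open>\<beta>\<close> and \<open>1 - \<beta>\<close>. Young's inequality is used for positive
  \<open>u\<close>; at the remaining point \<open>0 powr \<beta> = 0\<close>, even for
  \<open>\<beta> = 0\<close>.\<close>

lemma powr_le_tangent_at_1:
  fixes u \<beta> :: real
  assumes "0 \<le> u" "0 \<le> \<beta>" "\<beta> \<le> 1"
  shows "u powr \<beta> \<le> 1 - \<beta> + \<beta> * u"
proof (cases "u = 0")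
  case False
  then show ?thesis
    using Youngs_inequality_0[of \<beta> "1 - \<beta>" u 1] assms by (simp add: algebra_simps)
qed (use assms in auto)

text \<open>The bound is the value at \<open>x = 1 / 2\<close>. Multiplying by
  \<open>2 powr \<beta>\<close> moves that point to the point of tangency 1, and the two tangent
  bounds add up to 1 minus a nonnegative multiple of a square.\<close>

lemma interpolation_factor_le:
  fixes x \<beta> :: real
  assumes "0 \<le> x" "x \<le> 1" "0 \<le> \<beta>" "\<beta> \<le> 1"
  shows "(1 - x) * x powr \<beta> + x * (1 - x) powr \<beta> \<le> 1 / 2 powr \<beta>"
proof -
  have "2 powr \<beta> * ((1 - x) * x powr \<beta> + x * (1 - x) powr \<beta>)
      = (1 - x) * (2 * x) powr \<beta> + x * (2 * (1 - x)) powr \<beta>"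
    unfolding powr_mult by (simp add: algebra_simps)
  also have "\<dots> \<le> (1 - x) * (1 - \<beta> + \<beta> * (2 * x)) + x * (1 - \<beta> + \<beta> * (2 * (1 - x)))"
    using assms by (intro add_mono mult_left_mono powr_le_tangent_at_1) auto
  also have "\<dots> = 1 - \<beta> * (1 - 2 * x)\<^sup>2"
    by (simp add: power2_eq_square algebra_simps)
  also have "\<dots> \<le> 1"
    using assms by simp
  finally show ?thesis
    by (simp add: field_simps)
qed

section \<open>Linear interpolation error on one cell\<close>

definition lin_interp :: "(real \<Rightarrow> real) \<Rightarrow> real \<Rightarrow> real \<Rightarrow> real \<Rightarrow> real" where
  "lin_interp y a b s = y a + (y b - y a) / (b - a) * (s - a)"

text \<open>In the barycentric coordinate \<open>x = (b - s) / (b - a)\<close> the interpolant is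
  \<open>x * y a + (1 - x) * y b\<close>. Splitting \<open>y s\<close> with the same weights leaves
  only increments of \<open>y\<close> between \<open>s\<close> and an end point, which regularity of
  \<open>y\<close> controls.\<close>

lemma interp_error_eq:
  assumes "a < b"
  shows "y s - lin_interp y a b s
     = (b - s) / (b - a) * (y s - y a) - (1 - (b - s) / (b - a)) * (y b - y s)"
proof -
  define x where "x = (b - s) / (b - a)"
  have "s - a = (1 - x) * (b - a)"
    using assms by (simp add: x_def field_simps)
  then have "lin_interp y a b s = y a + (1 - x) * (y b - y a)"
    using assms by (simp add: lin_interp_def)
  then show ?thesis
    unfolding x_def[symmetric] by (simp add: algebra_simps)
qed

text \<open>The increment from \<open>a\<close> to \<open>s\<close> covers the fraction
  \<open>1 - x\<close> of the cell but carries the weight \<open>x\<close>, and conversely for the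
  other one. Hence the crossed factors.\<close>

lemma holder_interp_error:
  fixes y :: "real \<Rightarrow> real"
  assumes "a < b" "s \<in> {a..b}" and x: "x = (b - s) / (b - a)"
    and holder: "\<And>u v. \<lbrakk>u \<in> {a..b}; v \<in> {a..b}\<rbrakk> \<Longrightarrow> \<bar>y u - y v\<bar> \<le> H * \<bar>u - v\<bar> powr \<beta>"
  shows "\<bar>y s - lin_interp y a b s\<bar>
    \<le> H * (b - a) powr \<beta> * ((1 - x) * x powr \<beta> + x * (1 - x) powr \<beta>)"
proof -
  have x01: "0 \<le> x" "x \<le> 1" and s: "b - s = (b - a) * x" "s - a = (b - a) * (1 - x)"
    using assms(1,2) by (auto simp: x field_simps)
  have "\<bar>y s - lin_interp y a b s\<bar> \<le> x * \<bar>y s - y a\<bar> + (1 - x) * \<bar>y b - y s\<bar>"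
    unfolding interp_error_eq[OF assms(1)] x[symmetric]
    using x01 abs_triangle_ineq4[of "x * (y s - y a)" "(1 - x) * (y b - y s)"]
    by (simp add: abs_mult)
  also have "\<dots> \<le> x * (H * (s - a) powr \<beta>) + (1 - x) * (H * (b - s) powr \<beta>)"
    using x01 assms(1,2) holder[of s a] holder[of b s]
    by (intro add_mono mult_left_mono) auto
  also have "\<dots> = H * (b - a) powr \<beta> * ((1 - x) * x powr \<beta> + x * (1 - x) powr \<beta>)"
    unfolding s powr_mult by (simp add: algebra_simps)
  finally show ?thesis .
qed

lemma holder_deriv_interp_error:
  fixes y y' :: "real \<Rightarrow> real"
  assumes "a < b" "s \<in> {a..b}" and x: "x = (b - s) / (b - a)"
    and cont: "continuous_on {a..b} y"
    and deriv: "\<And>u. u \<in> {a<..<b} \<Longrightarrow> (y has_vector_derivative y' u) (at u)"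
    and holder: "\<And>u v. \<lbrakk>u \<in> {a<..<b}; v \<in> {a<..<b}; u \<noteq> v\<rbrakk> \<Longrightarrow> \<bar>y' u - y' v\<bar> \<le> H * \<bar>u - v\<bar> powr \<beta>"
    and \<beta>: "\<beta> \<ge> 0"
  shows "\<bar>y s - lin_interp y a b s\<bar> \<le> H * (b - a) powr (1 + \<beta>) * (x * (1 - x)) / (1 + \<beta>)"
\<comment> \<open>At an end point the error and \<open>x * (1 - x)\<close> both vanish. Elsewhere
  the moving points used below stay in the open cell, the only place where \<open>y\<close> is
  assumed differentiable.\<close>
proof (cases "s = a \<or> s = b")
  case True
  then show ?thesis
    using assms(1) by (auto simp: x lin_interp_def)
next
  case False
  define d e where "d = s - a" and "e = b - s"
  have de: "0 < d" "0 < e" "b - a = d + e"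
    using False assms(2) by (auto simp: d_def e_def)
  have xe: "x = e / (d + e)" "1 - x = d / (d + e)"
    using de by (simp_all add: x flip: de(3) e_def) (simp add: de(3) field_simps)
  \<comment> \<open>Let both end points of the cell retract to \<open>s\<close> at a common rate. At stage \<open>r\<close> they are only
    \<open>(b - a) * r\<close> apart, and integrating \<open>r powr \<beta>\<close> gains the factor \<open>1 / (1 + \<beta>)\<close>.\<close>
  define \<psi> where "\<psi> r = x * (y s - y (s - d * r)) - (1 - x) * (y (s + e * r) - y s)" for r
  define \<phi> where "\<phi> r = H * (b - a) powr (1 + \<beta>) * (x * (1 - x)) * (r powr (1 + \<beta>) / (1 + \<beta>))" for r
  have in_ab: "s - d * r \<in> {a..b}" "s + e * r \<in> {a..b}" if "r \<in> {0..1}" for r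
  proof -
    have "d * r \<le> d * 1" "e * r \<le> e * 1" "0 \<le> d * r" "0 \<le> e * r"
      using that de by (auto intro!: mult_left_mono mult_nonneg_nonneg simp del: mult_1_right)
    then show "s - d * r \<in> {a..b}" "s + e * r \<in> {a..b}"
      using assms(2) by (auto simp: d_def e_def)
  qed
  have in_ab': "s - d * r \<in> {a<..<b}" "s + e * r \<in> {a<..<b}" if "0 < r" "r < 1" for r
  proof -
    have "d * r < d * 1" "e * r < e * 1" "0 < d * r" "0 < e * r"
      using that de by (auto simp del: mult_1_right)
    then show "s - d * r \<in> {a<..<b}" "s + e * r \<in> {a<..<b}"
      by (auto simp: d_def e_def)
  qed
  have "norm (\<psi> 1 - \<psi> 0) \<le> \<phi> 1 - \<phi> 0"
  proof (rule differentiable_bound_general)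
    show "continuous_on {0..1} \<psi>"
      unfolding \<psi>_def
      by (intro continuous_intros continuous_on_compose2[OF cont]) (use in_ab in auto)
    show "continuous_on {0..1} \<phi>"
      unfolding \<phi>_def using \<beta> by (intro continuous_intros continuous_on_powr') auto
    fix r :: real
    assume r: "0 < r" "r < 1"
    have dy: "(y has_real_derivative y' u) (at u)" if "u \<in> {a<..<b}" for u
      using deriv[OF that] by (simp add: has_real_derivative_iff_has_vector_derivative)
    \<comment> \<open>Since \<open>x * d = (1 - x) * e = x * (1 - x) * (b - a)\<close>, the two
      values of \<open>y'\<close> enter with equal weight and only their difference remains, so the
      Hoelder bound applies.\<close>
    show "(\<psi> has_vector_derivative x * (1 - x) * (b - a) * (y' (s - d * r) - y' (s + e * r))) (at r)"
      unfolding \<psi>_def has_real_derivative_iff_has_vector_derivative[symmetric]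
      by (rule derivative_eq_intros DERIV_chain2[OF dy] in_ab'[OF r] refl)+
        (use de in \<open>simp add: xe field_simps\<close>)
    show "(\<phi> has_vector_derivative H * (b - a) powr (1 + \<beta>) * (x * (1 - x)) * r powr \<beta>) (at r)"
      unfolding \<phi>_def has_real_derivative_iff_has_vector_derivative[symmetric]
    proof (rule DERIV_cmult)
      show "((\<lambda>r. r powr (1 + \<beta>) / (1 + \<beta>)) has_real_derivative r powr \<beta>) (at r)"
        using r \<beta> by (auto intro!: derivative_eq_intros)
    qed
    have x01: "0 \<le> x" "0 \<le> 1 - x"
      using de by (auto simp: xe)
    have "s - d * r - (s + e * r) = - ((b - a) * r)"
      using de(3) by (simp add: algebra_simps)
    moreover have "(b - a) * r > 0"
      using assms(1) r by simp
    ultimately have "\<bar>s - d * r - (s + e * r)\<bar> = (b - a) * r" "s - d * r \<noteq> s + e * r"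
      by linarith+
    then have "\<bar>y' (s - d * r) - y' (s + e * r)\<bar> \<le> H * ((b - a) * r) powr \<beta>"
      using holder[of "s - d * r" "s + e * r"] in_ab'[OF r] by simp
    also have "\<dots> = H * ((b - a) powr \<beta> * r powr \<beta>)"
      using assms(1) r by (simp add: powr_mult)
    finally have "x * (1 - x) * (b - a) * \<bar>y' (s - d * r) - y' (s + e * r)\<bar>
       \<le> x * (1 - x) * (b - a) * (H * ((b - a) powr \<beta> * r powr \<beta>))"
      using x01 assms(1) by (intro mult_left_mono) auto
    then show "norm (x * (1 - x) * (b - a) * (y' (s - d * r) - y' (s + e * r)))
       \<le> H * (b - a) powr (1 + \<beta>) * (x * (1 - x)) * r powr \<beta>"
      using x01 assms(1) by (simp add: abs_mult powr_add mult_ac)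
  qed simp
  moreover have "\<psi> 1 - \<psi> 0 = y s - lin_interp y a b s"
    unfolding interp_error_eq[OF assms(1)] x[symmetric] by (simp add: \<psi>_def d_def e_def)
  ultimately show ?thesis
    using \<beta> by (simp add: \<phi>_def)
qed

section \<open>The truncation error as a sum over cells\<close>

text \<open>Abel summation. Integrating the slopes of the interpolant against the kernel produces
  weighted increments, whereas \<open>l1_caputo\<close> is written with weighted nodal values; the
  right-hand side is its bracket for \<open>n = Suc N\<close>.\<close>

lemma l1_weight_sum_by_parts:
  assumes "\<alpha> < 1"
  shows "(\<Sum>i<Suc N. l1_weight \<alpha> (N - i) * (v (Suc i) - v i))
    = v (Suc N) - l1_weight \<alpha> N * v 0
      - (\<Sum>i = 1..N. (l1_weight \<alpha> (N - i) - l1_weight \<alpha> (Suc N - i)) * v i)"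
proof -
  have w0: "l1_weight \<alpha> 0 = 1"
    using assms by (simp add: l1_weight_def)
  have "(\<Sum>i<Suc N. l1_weight \<alpha> (N - i) * v (Suc i)) = (\<Sum>i = 1..Suc N. l1_weight \<alpha> (Suc N - i) * v i)"
    by (rule sum.reindex_bij_witness[where i = "\<lambda>i. i - 1" and j = Suc]) auto
  also have "\<dots> = (\<Sum>i = 1..N. l1_weight \<alpha> (Suc N - i) * v i) + v (Suc N)"
    by (simp add: w0)
  finally have 1: "(\<Sum>i<Suc N. l1_weight \<alpha> (N - i) * v (Suc i)) = \<dots>" .
  have "{..<Suc N} = insert 0 {1..N}"
    by auto
  then have 2: "(\<Sum>i<Suc N. l1_weight \<alpha> (N - i) * v i)
      = l1_weight \<alpha> N * v 0 + (\<Sum>i = 1..N. l1_weight \<alpha> (N - i) * v i)"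
    by simp
  show ?thesis
    unfolding right_diff_distrib left_diff_distrib sum_subtractf 1 2 by simp
qed

text \<open>
  In the last cell, where \<open>b = t\<close>, the boundary terms at \<open>b\<close> vanish because \<open>0 powr _ = 0\<close> and \<open>x / 0 = 0\<close>.
\<close>

lemma caputo_kernel_lin_interp:
  fixes y :: "real \<Rightarrow> real"
  assumes "a < b" "b \<le> t" "0 < \<alpha>" "\<alpha> < 1"
  shows "((\<lambda>s. \<alpha> * ((y t - lin_interp y a b s) / (t - s) powr (1 + \<alpha>))) has_integral
     ((y t - y b) / (t - b) powr \<alpha> - (y t - y a) / (t - a) powr \<alpha>
      + (y b - y a) / (b - a) / (1 - \<alpha>) * ((t - a) powr (1 - \<alpha>) - (t - b) powr (1 - \<alpha>)))) {a..b}"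
proof -
  define m where "m = (y b - y a) / (b - a)"
  \<comment> \<open>The gap at \<open>t\<close> between \<open>y\<close> and the line prolonged from
    the cell. It is 0 when \<open>b = t\<close>, which removes the unbounded power
    \<open>(t - s) powr (- \<alpha>)\<close> from the last cell.\<close>
  define c where "c = y t - lin_interp y a b t"
  have split: "y t - lin_interp y a b s = c + m * (t - s)" for s
    using assms(1) by (simp add: c_def lin_interp_def m_def[symmetric] algebra_simps)
  have c0: "c = 0" if "b = t"
    using that assms(1) by (simp add: c_def lin_interp_def)
  \<comment> \<open>The coefficient \<open>- m * \<alpha> / (1 - \<alpha>)\<close> of the
    antiderivative is split: its part \<open>m\<close> joins the \<open>c\<close> term to form
    \<open>(y t - y s) / (t - s) powr \<alpha>\<close> at both ends, and its part
    \<open>- m / (1 - \<alpha>)\<close> yields the slope term.\<close>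
  define F where "F s = c * (t - s) powr (- \<alpha>) + (m - m / (1 - \<alpha>)) * (t - s) powr (1 - \<alpha>)" for s
  have cont: "continuous_on {a..b} (\<lambda>s. c * (t - s) powr (- \<alpha>))"
  proof (cases "b = t")
    case False
    then show ?thesis
      using assms by (auto intro!: continuous_intros)
  qed (simp add: c0)
  have mul: "(t - s) * (t - s) powr (- \<alpha>) = (t - s) powr (1 - \<alpha>)" if "s \<le> t" for s
    using powr_mult_base[of "t - s" "- \<alpha>"] that by simp
  have "((\<lambda>s. \<alpha> * ((y t - lin_interp y a b s) / (t - s) powr (1 + \<alpha>))) has_integral (F b - F a)) {a..b}"
  proof (rule fundamental_theorem_of_calculus_interior)
    show "continuous_on {a..b} F"
      unfolding F_def using assms
      by (intro continuous_on_add cont continuous_on_mult continuous_on_powr' continuous_intros) auto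
    fix s
    assume "s \<in> {a<..<b}"
    then have s: "t - s > 0"
      using assms by simp
    have e: "(t - s) powr (- \<alpha> - 1) = 1 / (t - s) powr (1 + \<alpha>)"
      by (rule powr_neg_minus_1)
    have e2: "(t - s) powr (- \<alpha>) = (t - s) / (t - s) powr (1 + \<alpha>)"
      using s by (simp add: powr_add powr_minus_divide)
    have "(F has_real_derivative
            c * (- \<alpha> * (t - s) powr (- \<alpha> - 1) * - 1)
            + (m - m / (1 - \<alpha>)) * ((1 - \<alpha>) * (t - s) powr (1 - \<alpha> - 1) * - 1)) (at s)"
      unfolding F_def using s by (auto intro!: derivative_eq_intros)
    also have "c * (- \<alpha> * (t - s) powr (- \<alpha> - 1) * - 1)
            + (m - m / (1 - \<alpha>)) * ((1 - \<alpha>) * (t - s) powr (1 - \<alpha> - 1) * - 1)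
        = c * \<alpha> * (t - s) powr (- \<alpha> - 1) + m * \<alpha> * (t - s) powr (- \<alpha>)"
      using assms by (simp add: field_simps)
    also have "\<dots> = \<alpha> * ((y t - lin_interp y a b s) / (t - s) powr (1 + \<alpha>))"
      unfolding e e2 split by (simp add: add_divide_distrib distrib_left mult_ac)
    finally show "(F has_vector_derivative \<dots>) (at s)"
      by (simp add: has_real_derivative_iff_has_vector_derivative)
  qed (use assms in simp)
  also have "F b - F a = (y t - y b) / (t - b) powr \<alpha> - (y t - y a) / (t - a) powr \<alpha>
      + m / (1 - \<alpha>) * ((t - a) powr (1 - \<alpha>) - (t - b) powr (1 - \<alpha>))"
  proof -
    have yb: "y t - y b = c + m * (t - b)" and ya: "y t - y a = c + m * (t - a)"
      using split[of a] split[of b] assms(1) by (auto simp: lin_interp_def)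
    have "(c + m * (t - s)) / (t - s) powr \<alpha> = c * (t - s) powr (- \<alpha>) + m * (t - s) powr (1 - \<alpha>)"
      if "s \<le> t" for s
      unfolding mul[OF that, symmetric] powr_minus_divide by (simp add: add_divide_distrib)
    then show ?thesis
      unfolding F_def yb ya using assms(1,2) by (simp add: algebra_simps)
  qed
  finally show ?thesis
    by (simp add: m_def)
qed

text \<open>Subtracting and adding the interpolant splits the integrand into a part with a known
  integral and the interpolation error over the kernel denominator. The latter is dominated by
  \<open>D\<close>, which gives both its integrability and the bound.\<close>

lemma caputo_kernel_piece:
  fixes y D :: "real \<Rightarrow> real"
  assumes "a < b" "b \<le> t" "0 < \<alpha>" "\<alpha> < 1"
    and cont: "continuous_on {a..b} y"
    and D: "(D has_integral V) {a..b}"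
    and bound: "\<And>s. s \<in> {a<..<b} \<Longrightarrow> \<bar>y s - lin_interp y a b s\<bar> / (t - s) powr (1 + \<alpha>) \<le> D s"
  obtains I where "((\<lambda>s. (y t - y s) / (t - s) powr (1 + \<alpha>)) has_integral I) {a..b}"
    and "\<bar>\<alpha> * I - ((y t - y b) / (t - b) powr \<alpha> - (y t - y a) / (t - a) powr \<alpha>
      + (y b - y a) / (b - a) / (1 - \<alpha>) * ((t - a) powr (1 - \<alpha>) - (t - b) powr (1 - \<alpha>)))\<bar> \<le> \<alpha> * V"
proof -
  let ?g = "\<lambda>s. (y s - lin_interp y a b s) / (t - s) powr (1 + \<alpha>)"
  let ?L = "(y t - y b) / (t - b) powr \<alpha> - (y t - y a) / (t - a) powr \<alpha>
      + (y b - y a) / (b - a) / (1 - \<alpha>) * ((t - a) powr (1 - \<alpha>) - (t - b) powr (1 - \<alpha>))"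
  have D': "(D has_integral V) {a<..<b}"
    using D by (simp add: has_integral_Icc_iff_Ioo)
  \<comment> \<open>For \<open>b = t\<close> the quotient may be singular at \<open>b\<close>. On
    the open cell the denominator is positive, so continuity supplies the measurability needed for
    domination.\<close>
  have contg: "continuous_on {a<..<b} ?g"
    unfolding lin_interp_def using assms(1,2)
    by (intro continuous_intros continuous_on_subset[OF cont]) auto
  have "?g integrable_on {a<..<b}"
    by (rule measurable_bounded_by_integrable_imp_integrable
          [OF continuous_imp_measurable_on_sets_lebesgue[OF contg], of D])
       (use D' bound in \<open>auto simp: has_integral_iff\<close>)
  then obtain J where J': "(?g has_integral J) {a<..<b}"
    by blast
  then have J: "(?g has_integral J) {a..b}"
    by (simp add: has_integral_Icc_iff_Ioo)
  have absJ: "\<bar>J\<bar> \<le> V"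
    using integral_norm_bound_integral[of ?g "{a<..<b}" D] D' J' bound by (auto simp: has_integral_iff)
  have "((\<lambda>s. \<alpha> * ((y t - lin_interp y a b s) / (t - s) powr (1 + \<alpha>)) / \<alpha> - ?g s) has_integral (?L / \<alpha> - J)) {a..b}"
    by (intro has_integral_diff J has_integral_divide caputo_kernel_lin_interp assms)
  also have "(\<lambda>s. \<alpha> * ((y t - lin_interp y a b s) / (t - s) powr (1 + \<alpha>)) / \<alpha> - ?g s)
     = (\<lambda>s. (y t - y s) / (t - s) powr (1 + \<alpha>))"
    using assms(3) by (auto simp: diff_divide_distrib)
  finally show ?thesis
    using that[of "?L / \<alpha> - J"] absJ assms(3) by (simp add: right_diff_distrib abs_mult)
qed

text \<open>The common core of both regularity cases, which only have to supply \<open>E\<close>,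
  \<open>D\<close> and \<open>V\<close>. The last cell needs its own majorant because a constant
  bound does not compensate for the nonintegrable kernel there.\<close>

lemma l1_truncation_bound:
  fixes y D :: "real \<Rightarrow> real"
  assumes "\<tau> > 0" "0 < \<alpha>" "\<alpha> < 1" and t: "t = real (Suc N) * \<tau>"
    and cont: "continuous_on {0..t} y"
    and E: "\<And>i s. \<lbrakk>i < N; s \<in> {real i * \<tau><..<real (Suc i) * \<tau>}\<rbrakk>
          \<Longrightarrow> \<bar>y s - lin_interp y (real i * \<tau>) (real (Suc i) * \<tau>) s\<bar> \<le> E"
    and D: "(D has_integral V) {real N * \<tau>..t}"
    and bound: "\<And>s. s \<in> {real N * \<tau><..<t}
          \<Longrightarrow> \<bar>y s - lin_interp y (real N * \<tau>) t s\<bar> / (t - s) powr (1 + \<alpha>) \<le> D s"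
  shows "\<bar>caputo \<alpha> y t - l1_caputo \<alpha> \<tau> y (Suc N)\<bar>
    \<le> ((1 - real (Suc N) powr (- \<alpha>)) * \<tau> powr (- \<alpha>) * E + \<alpha> * V) / Gamma (1 - \<alpha>)"
proof -
  define p where "p i = real i * \<tau>" for i
  let ?f = "\<lambda>s. (y t - y s) / (t - s) powr (1 + \<alpha>)"
  define G where "G s = (y t - y s) / (t - s) powr \<alpha>" for s
  \<comment> \<open>The explicit value from \<open>caputo_kernel_lin_interp\<close> on cell
    \<open>i\<close>: \<open>\<alpha>\<close> times the kernel integral with \<open>y s\<close>
    replaced by the interpolant.\<close>
  define A where "A i = G (p (Suc i)) - G (p i)
     + (y (p (Suc i)) - y (p i)) / (p (Suc i) - p i) / (1 - \<alpha>)
       * ((t - p i) powr (1 - \<alpha>) - (t - p (Suc i)) powr (1 - \<alpha>))" for i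
  \<comment> \<open>Before the last cell this is \<open>E\<close> times the exact integral of
    \<open>(t - s) powr (- \<alpha> - 1)\<close>.\<close>
  define W where "W i = (if i < N then E / \<alpha> * ((t - p (Suc i)) powr (- \<alpha>) - (t - p i) powr (- \<alpha>)) else V)" for i
  have p_less: "p i < p (Suc i)" and p_nonneg: "0 \<le> p i" and p_diff: "p (Suc i) - p i = \<tau>" for i
    using assms(1) by (auto simp: p_def algebra_simps)
  have p_le: "p i \<le> p j" if "i \<le> j" for i j
    using that assms(1) by (simp add: p_def)
  have tp: "t = p (Suc N)"
    by (simp add: t p_def)
  have p0: "p 0 = 0"
    by (simp add: p_def)

  have "\<exists>I. (?f has_integral I) {p i..p (Suc i)} \<and> \<bar>\<alpha> * I - A i\<bar> \<le> \<alpha> * W i" if "i < Suc N" for i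
  proof -
    have le_t: "p (Suc i) \<le> t"
      unfolding tp using that by (intro p_le) simp
    have conti: "continuous_on {p i..p (Suc i)} y"
      using p_nonneg[of i] le_t by (intro continuous_on_subset[OF cont]) auto
    have "\<exists>D'. (D' has_integral W i) {p i..p (Suc i)} \<and>
       (\<forall>s\<in>{p i<..<p (Suc i)}. \<bar>y s - lin_interp y (p i) (p (Suc i)) s\<bar> / (t - s) powr (1 + \<alpha>) \<le> D' s)"
    proof (cases "i < N")
      case True
      have lt: "p (Suc i) < t"
        unfolding tp using True p_less[of N] p_le[of "Suc i" N] by simp
      have "((\<lambda>s. E * (t - s) powr (- \<alpha> - 1)) has_integral
              (E / \<alpha> * (t - p (Suc i)) powr (- \<alpha>) - E / \<alpha> * (t - p i) powr (- \<alpha>))) {p i..p (Suc i)}"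
      proof (rule fundamental_theorem_of_calculus_interior)
        show "continuous_on {p i..p (Suc i)} (\<lambda>s. E / \<alpha> * (t - s) powr (- \<alpha>))"
          using lt by (intro continuous_intros) auto
        show "((\<lambda>s. E / \<alpha> * (t - s) powr (- \<alpha>)) has_vector_derivative E * (t - s) powr (- \<alpha> - 1)) (at s)"
          if "s \<in> {p i<..<p (Suc i)}" for s
          unfolding has_real_derivative_iff_has_vector_derivative[symmetric]
          using that lt assms by (auto intro!: derivative_eq_intros)
      qed (use p_less[of i] in simp)
      moreover have "\<bar>y s - lin_interp y (p i) (p (Suc i)) s\<bar> / (t - s) powr (1 + \<alpha>) \<le> E * (t - s) powr (- \<alpha> - 1)"
        if "s \<in> {p i<..<p (Suc i)}" for s
      proof -
        have "(t - s) powr (- \<alpha> - 1) = 1 / (t - s) powr (1 + \<alpha>)"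
          by (rule powr_neg_minus_1)
        then show ?thesis
          using E[OF True] that by (simp add: p_def divide_right_mono)
      qed
      ultimately show ?thesis
        using True by (auto simp: W_def right_diff_distrib)
    next
      case False
      then have "i = N"
        using that by simp
      then show ?thesis
        using D bound by (intro exI[of _ D]) (simp add: W_def p_def t)
    qed
    then obtain D' where D': "(D' has_integral W i) {p i..p (Suc i)}"
       "\<And>s. s \<in> {p i<..<p (Suc i)} \<Longrightarrow> \<bar>y s - lin_interp y (p i) (p (Suc i)) s\<bar> / (t - s) powr (1 + \<alpha>) \<le> D' s"
      by blast
    show ?thesis
      by (rule caputo_kernel_piece[OF p_less le_t assms(2,3) conti D']) (auto simp: A_def G_def)
  qed
  then obtain I where I: "\<And>i. i < Suc N \<Longrightarrow> (?f has_integral I i) {p i..p (Suc i)}"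
      and IA: "\<And>i. i < Suc N \<Longrightarrow> \<bar>\<alpha> * I i - A i\<bar> \<le> \<alpha> * W i"
    by metis

  have "(?f has_integral (\<Sum>i<m. I i)) {0..p m}" if "m \<le> Suc N" for m
    using that
  proof (induction m)
    case 0
    then show ?case
      using has_integral_refl(2)[of ?f 0] by (simp add: p0)
  next
    case (Suc m)
    then have "(?f has_integral ((\<Sum>i<m. I i) + I m)) {0..p (Suc m)}"
      using p_nonneg[of m] p_less[of m] by (intro has_integral_combine[OF _ _ _ I]) auto
    then show ?case
      by simp
  qed
  then have int: "integral {0..t} ?f = (\<Sum>i<Suc N. I i)"
    unfolding tp using order_refl by blast

  define S where "S = (\<Sum>i<Suc N. l1_weight \<alpha> (N - i) * (y (p (Suc i)) - y (p i)))"
  have "A i = G (p (Suc i)) - G (p i) + \<tau> powr (- \<alpha>) / (1 - \<alpha>) * (l1_weight \<alpha> (N - i) * (y (p (Suc i)) - y (p i)))"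
    if "i < Suc N" for i
  proof -
    have "t - p i = (real (N - i) + 1) * \<tau>" "t - p (Suc i) = real (N - i) * \<tau>"
      using that by (auto simp: t p_def of_nat_diff algebra_simps)
    then have "(t - p i) powr (1 - \<alpha>) - (t - p (Suc i)) powr (1 - \<alpha>) = \<tau> powr (1 - \<alpha>) * l1_weight \<alpha> (N - i)"
      by (simp only: powr_mult l1_weight_def right_diff_distrib mult.commute)
    also have "\<tau> powr (1 - \<alpha>) = \<tau> * \<tau> powr (- \<alpha>)"
      using powr_mult_base[of \<tau> "- \<alpha>"] assms(1) by simp
    finally show ?thesis
      using assms(1) by (simp add: A_def p_diff)
  qed
  then have "(\<Sum>i<Suc N. A i) = (\<Sum>i<Suc N. G (p (Suc i)) - G (p i)) + \<tau> powr (- \<alpha>) / (1 - \<alpha>) * S"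
    unfolding S_def sum_distrib_left sum.distrib[symmetric] by (intro sum.cong) auto
  \<comment> \<open>\<open>G t = 0\<close> because its numerator vanishes, so the telescope leaves
    the boundary quotient of \<open>caputo\<close> with the opposite sign.\<close>
  also have "(\<Sum>i<Suc N. G (p (Suc i)) - G (p i)) = - ((y t - y 0) / t powr \<alpha>)"
    using sum_lessThan_telescope[of "\<lambda>i. G (p i)" "Suc N"] unfolding tp[symmetric] by (simp add: G_def p0)
  finally have sumA: "(\<Sum>i<Suc N. A i) = \<tau> powr (- \<alpha>) / (1 - \<alpha>) * S - (y t - y 0) / t powr \<alpha>"
    by simp

  have \<Gamma>: "Gamma (2 - \<alpha>) = (1 - \<alpha>) * Gamma (1 - \<alpha>)" and \<Gamma>pos: "Gamma (1 - \<alpha>) > 0"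
    using Gamma_pos_plus1[of "1 - \<alpha>"] assms(2,3) by (auto simp: Gamma_real_pos)
  have "l1_caputo \<alpha> \<tau> y (Suc N) = \<tau> powr (- \<alpha>) / Gamma (2 - \<alpha>) * S"
    unfolding S_def using l1_weight_sum_by_parts[OF assms(3), of N "\<lambda>i. y (p i)"]
    by (simp add: l1_caputo_def p_def)
  also have "\<dots> = (\<tau> powr (- \<alpha>) / (1 - \<alpha>) * S) / Gamma (1 - \<alpha>)"
    unfolding \<Gamma> by simp
  finally have "l1_caputo \<alpha> \<tau> y (Suc N) = ((\<Sum>i<Suc N. A i) + (y t - y 0) / t powr \<alpha>) / Gamma (1 - \<alpha>)"
    unfolding sumA by simp
  then have "caputo \<alpha> y t - l1_caputo \<alpha> \<tau> y (Suc N) = (\<Sum>i<Suc N. \<alpha> * I i - A i) / Gamma (1 - \<alpha>)"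
    unfolding caputo_def int
    by (simp add: sum_subtractf sum_distrib_left diff_divide_distrib add_divide_distrib algebra_simps)
  moreover have "\<bar>\<Sum>i<Suc N. \<alpha> * I i - A i\<bar> \<le> (\<Sum>i<Suc N. \<alpha> * W i)"
    by (rule sum_abs[THEN order_trans], rule sum_mono) (use IA in auto)
  moreover have "(\<Sum>i<Suc N. \<alpha> * W i) = (1 - real (Suc N) powr (- \<alpha>)) * \<tau> powr (- \<alpha>) * E + \<alpha> * V"
  proof -
    have "(\<Sum>i<N. \<alpha> * W i) = (\<Sum>i<N. E * (t - p (Suc i)) powr (- \<alpha>) - E * (t - p i) powr (- \<alpha>))"
      using assms(2) by (intro sum.cong) (auto simp: W_def right_diff_distrib)
    \<comment> \<open>The kernel integrals telescope to the distances \<open>\<tau>\<close> and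
      \<open>Suc N * \<tau>\<close> from \<open>t\<close>, the origin of the factor
      \<open>1 - n powr (- \<alpha>)\<close>.\<close>
    also have "\<dots> = E * (t - p N) powr (- \<alpha>) - E * t powr (- \<alpha>)"
      by (subst sum_lessThan_telescope) (simp add: p0)
    also have "t - p N = \<tau>"
      by (simp add: tp p_diff)
    also have "t powr (- \<alpha>) = real (Suc N) powr (- \<alpha>) * \<tau> powr (- \<alpha>)"
      unfolding t by (simp only: powr_mult)
    finally show ?thesis
      by (simp add: W_def algebra_simps)
  qed
  ultimately show ?thesis
    using \<Gamma>pos by (simp add: divide_right_mono)
qed

section \<open>Beta integrals on the last cell\<close>

lemma has_integral_reflect_scale:
  fixes f :: "real \<Rightarrow> real"
  assumes f: "(f has_integral I) {0..1}" and "a < b"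
  shows "((\<lambda>s. f ((b - s) / (b - a))) has_integral (b - a) * I) {a..b}"
proof -
  have m: "- (1 / (b - a)) \<noteq> 0"
    using assms(2) by simp
  have e: "(\<lambda>x. f (- (1 / (b - a)) *\<^sub>R x + b / (b - a))) = (\<lambda>s. f ((b - s) / (b - a)))"
    by (simp add: diff_divide_distrib)
  have "(a - b) * b / (b - a) = - b"
    using assms(2) by (simp add: field_simps)
  then have "(\<lambda>x. (1 / - (1 / (b - a))) *\<^sub>R x + - ((1 / - (1 / (b - a))) *\<^sub>R (b / (b - a)))) ` cbox 0 1
      = (\<lambda>x. - (b - a) * x + b) ` {0..1}"
    using assms(2) by simp
  also have "\<dots> = {a..b}"
    using assms(2) image_affinity_atLeastAtMost[of "- (b - a)" b 0 1] by simp
  finally show ?thesis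
    using has_integral_affinity[OF f[folded cbox_interval] m, of "b / (b - a)"] assms(2)
    unfolding e by simp
qed

text \<open>Substituting \<open>x = (b - s) / (b - a)\<close> makes the integral independent of the
  cell: the Jacobian \<open>b - a\<close> and the kernel's
  \<open>(b - a) powr (- (1 + \<alpha>))\<close> combine to the single power in front.\<close>

lemma has_integral_last_cell:
  fixes \<phi> :: "real \<Rightarrow> real"
  assumes \<phi>: "((\<lambda>x. \<phi> x * x powr (- (1 + \<alpha>))) has_integral I) {0..1}" and "a < b"
  shows "((\<lambda>s. K * \<phi> ((b - s) / (b - a)) / (b - s) powr (1 + \<alpha>)) has_integral (b - a) powr (- \<alpha>) * (K * I)) {a..b}"
proof -
  let ?h = "\<lambda>x. K * (b - a) powr (- (1 + \<alpha>)) * (\<phi> x * x powr (- (1 + \<alpha>)))"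
  have "((\<lambda>s. ?h ((b - s) / (b - a))) has_integral (b - a) * (K * (b - a) powr (- (1 + \<alpha>)) * I)) {a..b}"
    by (intro has_integral_reflect_scale has_integral_mult_right \<phi> assms)
  also have "(b - a) * (K * (b - a) powr (- (1 + \<alpha>)) * I) = (b - a) powr (- \<alpha>) * (K * I)"
    using powr_mult_base[of "b - a" "- (1 + \<alpha>)"] assms(2) by simp
  finally show ?thesis
  proof (rule has_integral_eq[rotated])
    show "?h ((b - s) / (b - a)) = K * \<phi> ((b - s) / (b - a)) / (b - s) powr (1 + \<alpha>)"
      if "s \<in> {a..b}" for s
    proof -
      have "(b - s) powr (- (1 + \<alpha>)) = (b - a) powr (- (1 + \<alpha>)) * ((b - s) / (b - a)) powr (- (1 + \<alpha>))"
        using assms(2) by (simp flip: powr_mult)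
      moreover have "K * \<phi> ((b - s) / (b - a)) / (b - s) powr (1 + \<alpha>)
          = K * \<phi> ((b - s) / (b - a)) * (b - s) powr (- (1 + \<alpha>))"
        by (simp only: powr_minus_divide) simp
      ultimately show ?thesis
        by (simp only: mult_ac)
    qed
  qed
qed

text \<open>The summands are Beta integrals with parameters \<open>(\<beta> - \<alpha>, 2)\<close>
  and \<open>(1 - \<alpha>, 1 + \<beta>)\<close>. The first converges because
  \<open>\<alpha> < \<beta>\<close>, and two steps of the Gamma recurrence make it rational.\<close>

lemma holder_cell_integral:
  fixes \<alpha> \<beta> :: real
  assumes "0 < \<alpha>" "\<alpha> < \<beta>" "\<beta> \<le> 1" "\<alpha> < 1"
  shows "((\<lambda>x. ((1 - x) * x powr \<beta> + x * (1 - x) powr \<beta>) * x powr (- (1 + \<alpha>))) has_integral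
     (1 / ((\<beta> - \<alpha>) * (1 + \<beta> - \<alpha>)) + Gamma (1 - \<alpha>) * Gamma (1 + \<beta>) / Gamma (2 + \<beta> - \<alpha>))) {0..1}"
proof -
  have "((\<lambda>x. x powr (\<beta> - \<alpha> - 1) * (1 - x) powr (2 - 1) + x powr (1 - \<alpha> - 1) * (1 - x) powr (1 + \<beta> - 1))
     has_integral (Beta (\<beta> - \<alpha>) 2 + Beta (1 - \<alpha>) (1 + \<beta>))) {0..1}"
    using assms by (intro has_integral_add has_integral_Beta_real) auto
  moreover have "Beta (\<beta> - \<alpha>) 2 = 1 / ((\<beta> - \<alpha>) * (1 + \<beta> - \<alpha>))"
  proof -
    have "Gamma (\<beta> - \<alpha> + 2) = (1 + \<beta> - \<alpha>) * ((\<beta> - \<alpha>) * Gamma (\<beta> - \<alpha>))"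
      using Gamma_pos_plus1[of "\<beta> - \<alpha>"] Gamma_pos_plus1[of "\<beta> - \<alpha> + 1"] assms
      by (simp add: add.assoc add.commute)
    moreover have "Gamma (2::real) = 1"
      using Gamma_pos_plus1[of 1] by simp
    moreover have "Gamma (\<beta> - \<alpha>) > 0"
      using assms by (simp add: Gamma_real_pos)
    ultimately show ?thesis
      by (simp add: Beta_def)
  qed
  moreover have "Beta (1 - \<alpha>) (1 + \<beta>) = Gamma (1 - \<alpha>) * Gamma (1 + \<beta>) / Gamma (2 + \<beta> - \<alpha>)"
    by (simp add: Beta_def algebra_simps)
  ultimately have "((\<lambda>x. x powr (\<beta> - \<alpha> - 1) * (1 - x) powr (2 - 1) + x powr (1 - \<alpha> - 1) * (1 - x) powr (1 + \<beta> - 1))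
     has_integral (1 / ((\<beta> - \<alpha>) * (1 + \<beta> - \<alpha>)) + Gamma (1 - \<alpha>) * Gamma (1 + \<beta>) / Gamma (2 + \<beta> - \<alpha>))) {0..1}"
    by simp
  then show ?thesis
  proof (rule has_integral_eq[rotated])
    show "x powr (\<beta> - \<alpha> - 1) * (1 - x) powr (2 - 1) + x powr (1 - \<alpha> - 1) * (1 - x) powr (1 + \<beta> - 1)
        = ((1 - x) * x powr \<beta> + x * (1 - x) powr \<beta>) * x powr (- (1 + \<alpha>))" if "x \<in> {0..1}" for x
    \<comment> \<open>At 0 both sides are 0 by the convention \<open>0 powr _ = 0\<close>; the
      exponent laws serve the other points.\<close>
    proof (cases "x = 0")
      case False
      then have "x powr (\<beta> - \<alpha> - 1) = x powr \<beta> * x powr (- (1 + \<alpha>))" "x powr (1 - \<alpha> - 1) = x * x powr (- (1 + \<alpha>))"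
        using that powr_mult_base[of x "- (1 + \<alpha>)"] by (auto simp flip: powr_add simp: algebra_simps)
      then show ?thesis
        using that by (simp add: algebra_simps)
    qed simp
  qed
qed

text \<open>The factor \<open>x\<close> weakens the singularity to the exponent
  \<open>- \<alpha>\<close>, leaving one Beta integral with parameters
  \<open>(1 - \<alpha>, 2)\<close>.\<close>

lemma holder_deriv_cell_integral:
  fixes \<alpha> :: real
  assumes "0 < \<alpha>" "\<alpha> < 1"
  shows "((\<lambda>x. x * (1 - x) * x powr (- (1 + \<alpha>))) has_integral (Gamma (1 - \<alpha>) / Gamma (3 - \<alpha>))) {0..1}"
proof -
  have "((\<lambda>x. x powr (1 - \<alpha> - 1) * (1 - x) powr (2 - 1)) has_integral Beta (1 - \<alpha>) 2) {0..1}"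
    using assms by (intro has_integral_Beta_real) auto
  moreover have "Beta (1 - \<alpha>) 2 = Gamma (1 - \<alpha>) / Gamma (3 - \<alpha>)"
    using Gamma_pos_plus1[of 1] by (simp add: Beta_def)
  ultimately have "((\<lambda>x. x powr (1 - \<alpha> - 1) * (1 - x) powr (2 - 1)) has_integral (Gamma (1 - \<alpha>) / Gamma (3 - \<alpha>))) {0..1}"
    by simp
  then show ?thesis
  proof (rule has_integral_eq[rotated])
    show "x powr (1 - \<alpha> - 1) * (1 - x) powr (2 - 1) = x * (1 - x) * x powr (- (1 + \<alpha>))" if "x \<in> {0..1}" for x
      using that powr_mult_base[of x "- (1 + \<alpha>)"] by (auto simp: algebra_simps)
  qed
qed

section \<open>Finite Hoelder seminorms\<close>

text \<open>With \<open>b > 0\<close> the pair \<open>(0, b)\<close> is admissible, so the supremum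
  is nonnegative rather than the value minus infinity of an empty one, and an upper bound makes it
  real.\<close>

lemma holder_seminormD:
  assumes "b > 0" "holder_seminorm \<beta> b z < \<infinity>"
  obtains H where "holder_seminorm \<beta> b z = ereal H" "0 \<le> H"
    "\<And>u v. \<lbrakk>u \<in> {0..b}; v \<in> {0..b}; u \<noteq> v\<rbrakk> \<Longrightarrow> \<bar>z u - z v\<bar> \<le> H * \<bar>u - v\<bar> powr \<beta>"
proof -
  have upper: "ereal (\<bar>z u - z v\<bar> / \<bar>u - v\<bar> powr \<beta>) \<le> holder_seminorm \<beta> b z"
    if "u \<in> {0..b}" "v \<in> {0..b}" "u \<noteq> v" for u v
    unfolding holder_seminorm_def by (rule SUP_upper2[of "(u, v)"]) (use that in auto)
  have "0 \<le> holder_seminorm \<beta> b z"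
    by (rule order_trans[OF _ upper[of 0 b]]) (use assms(1) in auto)
  then obtain H where H: "holder_seminorm \<beta> b z = ereal H" "0 \<le> H"
    using assms(2) by (cases "holder_seminorm \<beta> b z") auto
  show ?thesis
    using that[OF H] upper unfolding H by (simp add: field_simps)
qed

lemma holder_seminorm_mono:
  assumes "b \<le> c"
  shows "holder_seminorm \<beta> b z \<le> holder_seminorm \<beta> c z"
  unfolding holder_seminorm_def by (rule SUP_subset_mono) (use assms in auto)

section \<open>Truncation bounds for the two regularity classes\<close>

lemma l1_truncation_holder:
  fixes y :: "real \<Rightarrow> real"
  assumes "0 < \<alpha>" "\<alpha> < \<beta>" "\<beta> \<le> 1" "\<alpha> < 1" "\<tau> > 0" and t: "t = real (Suc N) * \<tau>"
    and cont: "continuous_on {0..t} y" and "H \<ge> 0"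
    and holder: "\<And>u v. \<lbrakk>u \<in> {0..t}; v \<in> {0..t}\<rbrakk> \<Longrightarrow> \<bar>y u - y v\<bar> \<le> H * \<bar>u - v\<bar> powr \<beta>"
  shows "\<bar>caputo \<alpha> y t - l1_caputo \<alpha> \<tau> y (Suc N)\<bar> \<le> l1_error_const \<alpha> \<beta> 0 (Suc N) * H * \<tau> powr (\<beta> - \<alpha>)"
proof -
  define \<phi> where "\<phi> x = (1 - x) * x powr \<beta> + x * (1 - x) powr \<beta>" for x :: real
  define K where "K = H * \<tau> powr \<beta>"
  let ?M = "1 / ((\<beta> - \<alpha>) * (1 + \<beta> - \<alpha>)) + Gamma (1 - \<alpha>) * Gamma (1 + \<beta>) / Gamma (2 + \<beta> - \<alpha>)"
  have K: "K \<ge> 0"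
    using assms by (simp add: K_def)
  have cell: "\<bar>y s - lin_interp y (real i * \<tau>) (real (Suc i) * \<tau>) s\<bar> \<le> K * \<phi> ((real (Suc i) * \<tau> - s) / \<tau>)"
    if "i \<le> N" "s \<in> {real i * \<tau>..real (Suc i) * \<tau>}" for i s
  proof -
    have "0 \<le> real i * \<tau>" "real (Suc i) * \<tau> \<le> t"
      unfolding t using that assms(5) by (auto intro!: mult_right_mono)
    then have sub: "{real i * \<tau>..real (Suc i) * \<tau>} \<subseteq> {0..t}"
      by auto
    have "\<bar>y s - lin_interp y (real i * \<tau>) (real (Suc i) * \<tau>) s\<bar>
      \<le> H * (real (Suc i) * \<tau> - real i * \<tau>) powr \<beta> * \<phi> ((real (Suc i) * \<tau> - s) / (real (Suc i) * \<tau> - real i * \<tau>))"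
      unfolding \<phi>_def using that assms(5)
      by (intro holder_interp_error holder subsetD[OF sub]) auto
    then show ?thesis
      by (simp add: K_def algebra_simps)
  qed
  have w: "t - real N * \<tau> = \<tau>"
    by (simp add: t algebra_simps)
  have "\<bar>caputo \<alpha> y t - l1_caputo \<alpha> \<tau> y (Suc N)\<bar>
    \<le> ((1 - real (Suc N) powr (- \<alpha>)) * \<tau> powr (- \<alpha>) * (K * (1 / 2 powr \<beta>)) + \<alpha> * (\<tau> powr (- \<alpha>) * (K * ?M))) / Gamma (1 - \<alpha>)"
  proof (rule l1_truncation_bound)
    show "\<bar>y s - lin_interp y (real i * \<tau>) (real (Suc i) * \<tau>) s\<bar> \<le> K * (1 / 2 powr \<beta>)"
      if "i < N" "s \<in> {real i * \<tau><..<real (Suc i) * \<tau>}" for i s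
    proof (rule order_trans[OF cell mult_left_mono[OF _ K]])
      show "\<phi> ((real (Suc i) * \<tau> - s) / \<tau>) \<le> 1 / 2 powr \<beta>"
        unfolding \<phi>_def using that assms by (intro interpolation_factor_le) (auto simp: field_simps)
    qed (use that in auto)
    show "((\<lambda>s. K * \<phi> ((t - s) / \<tau>) / (t - s) powr (1 + \<alpha>)) has_integral \<tau> powr (- \<alpha>) * (K * ?M)) {real N * \<tau>..t}"
      using has_integral_last_cell[of \<phi> \<alpha> ?M "real N * \<tau>" t K] holder_cell_integral[of \<alpha> \<beta>] assms(1-5)
      unfolding w \<phi>_def[symmetric] by (simp add: t)
    show "\<bar>y s - lin_interp y (real N * \<tau>) t s\<bar> / (t - s) powr (1 + \<alpha>) \<le> K * \<phi> ((t - s) / \<tau>) / (t - s) powr (1 + \<alpha>)"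
      if "s \<in> {real N * \<tau><..<t}" for s
      using cell[of N s] that by (intro divide_right_mono) (auto simp: t)
  qed (use assms in auto)
  \<comment> \<open>The prefactor \<open>1 / Gamma (1 - \<alpha>)\<close> cancels the same Gamma
    value in the second Beta term, so the third summand of the constant is free of it.\<close>
  also have "\<dots> = l1_error_const \<alpha> \<beta> 0 (Suc N) * H * \<tau> powr (\<beta> - \<alpha>)"
  proof -
    have "\<tau> powr (\<beta> - \<alpha>) = \<tau> powr \<beta> * \<tau> powr (- \<alpha>)"
      by (simp flip: powr_add)
    moreover have "Gamma (1 - \<alpha>) > 0"
      using assms by (simp add: Gamma_real_pos)
    ultimately show ?thesis
      unfolding l1_error_const_def K_def
      by (simp add: add_divide_distrib distrib_left distrib_right mult_ac)
  qed
  finally show ?thesis .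
qed

lemma l1_truncation_holder_deriv:
  fixes y y' :: "real \<Rightarrow> real"
  assumes "0 < \<alpha>" "\<alpha> < 1" "0 \<le> \<beta>" "\<tau> > 0" and t: "t = real (Suc N) * \<tau>"
    and cont: "continuous_on {0..t} y" and "H \<ge> 0"
    and deriv: "\<And>u. u \<in> {0<..<t} \<Longrightarrow> (y has_vector_derivative y' u) (at u)"
    and holder: "\<And>u v. \<lbrakk>u \<in> {0..t}; v \<in> {0..t}; u \<noteq> v\<rbrakk> \<Longrightarrow> \<bar>y' u - y' v\<bar> \<le> H * \<bar>u - v\<bar> powr \<beta>"
  shows "\<bar>caputo \<alpha> y t - l1_caputo \<alpha> \<tau> y (Suc N)\<bar> \<le> l1_error_const \<alpha> \<beta> 1 (Suc N) * H * \<tau> powr (1 + \<beta> - \<alpha>)"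
proof -
  define \<phi> where "\<phi> x = x * (1 - x)" for x :: real
  define K where "K = H * \<tau> powr (1 + \<beta>) / (1 + \<beta>)"
  let ?M = "Gamma (1 - \<alpha>) / Gamma (3 - \<alpha>)"
  have K: "K \<ge> 0"
    using assms by (simp add: K_def)
  \<comment> \<open>The maximum of \<open>x * (1 - x)\<close>, attained at the midpoint, is the
    source of the 4 in the constant.\<close>
  have \<phi>_le: "\<phi> x \<le> 1 / 4" for x
    using zero_le_power2[of "1 - 2 * x"] by (simp add: \<phi>_def power2_eq_square algebra_simps)
  have cell: "\<bar>y s - lin_interp y (real i * \<tau>) (real (Suc i) * \<tau>) s\<bar> \<le> K * \<phi> ((real (Suc i) * \<tau> - s) / \<tau>)"
    if "i \<le> N" "s \<in> {real i * \<tau>..real (Suc i) * \<tau>}" for i s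
  proof -
    have sub: "0 \<le> real i * \<tau>" "real (Suc i) * \<tau> \<le> t"
      unfolding t using that assms(4) by (auto intro!: mult_right_mono)
    have "\<bar>y s - lin_interp y (real i * \<tau>) (real (Suc i) * \<tau>) s\<bar>
      \<le> H * (real (Suc i) * \<tau> - real i * \<tau>) powr (1 + \<beta>) *
         ((real (Suc i) * \<tau> - s) / (real (Suc i) * \<tau> - real i * \<tau>)
          * (1 - (real (Suc i) * \<tau> - s) / (real (Suc i) * \<tau> - real i * \<tau>))) / (1 + \<beta>)"
    proof (rule holder_deriv_interp_error)
      show "continuous_on {real i * \<tau>..real (Suc i) * \<tau>} y"
        using sub by (intro continuous_on_subset[OF cont]) auto
      show "(y has_vector_derivative y' u) (at u)" if "u \<in> {real i * \<tau><..<real (Suc i) * \<tau>}" for u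
        using that sub by (intro deriv) auto
      show "\<bar>y' u - y' v\<bar> \<le> H * \<bar>u - v\<bar> powr \<beta>"
        if "u \<in> {real i * \<tau><..<real (Suc i) * \<tau>}" "v \<in> {real i * \<tau><..<real (Suc i) * \<tau>}" "u \<noteq> v" for u v
        using that sub by (intro holder) auto
    qed (use that assms(3,4) in auto)
    moreover have "real (Suc i) * \<tau> - real i * \<tau> = \<tau>"
      by (simp add: algebra_simps)
    ultimately show ?thesis
      by (simp add: K_def \<phi>_def mult.commute)
  qed
  have w: "t - real N * \<tau> = \<tau>"
    by (simp add: t algebra_simps)
  have "\<bar>caputo \<alpha> y t - l1_caputo \<alpha> \<tau> y (Suc N)\<bar>
    \<le> ((1 - real (Suc N) powr (- \<alpha>)) * \<tau> powr (- \<alpha>) * (K * (1 / 4)) + \<alpha> * (\<tau> powr (- \<alpha>) * (K * ?M))) / Gamma (1 - \<alpha>)"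
  proof (rule l1_truncation_bound)
    show "\<bar>y s - lin_interp y (real i * \<tau>) (real (Suc i) * \<tau>) s\<bar> \<le> K * (1 / 4)"
      if "i < N" "s \<in> {real i * \<tau><..<real (Suc i) * \<tau>}" for i s
      by (rule order_trans[OF cell mult_left_mono[OF \<phi>_le K]]) (use that in auto)
    show "((\<lambda>s. K * \<phi> ((t - s) / \<tau>) / (t - s) powr (1 + \<alpha>)) has_integral \<tau> powr (- \<alpha>) * (K * ?M)) {real N * \<tau>..t}"
      using has_integral_last_cell[of \<phi> \<alpha> ?M "real N * \<tau>" t K] holder_deriv_cell_integral[of \<alpha>] assms(1-4)
      unfolding w \<phi>_def[symmetric] by (simp add: t)
    show "\<bar>y s - lin_interp y (real N * \<tau>) t s\<bar> / (t - s) powr (1 + \<alpha>) \<le> K * \<phi> ((t - s) / \<tau>) / (t - s) powr (1 + \<alpha>)"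
      if "s \<in> {real N * \<tau><..<t}" for s
      using cell[of N s] that by (intro divide_right_mono) (auto simp: t)
  qed (use assms in auto)
  also have "\<dots> = ((1 - real (Suc N) powr (- \<alpha>)) / (4 * (\<beta> + 1) * Gamma (1 - \<alpha>)) + \<alpha> / Gamma (3 - \<alpha>) / (1 + \<beta>))
       * (H * \<tau> powr (1 + \<beta> - \<alpha>))"
  proof -
    have split: "\<tau> powr (1 + \<beta> - \<alpha>) = \<tau> powr (1 + \<beta>) * \<tau> powr (- \<alpha>)"
      by (simp flip: powr_add)
    \<comment> \<open>Powers and Gamma values become variables, which leaves plain field
      arithmetic.\<close>
    have gen: "(m * a * (H * b / q * (1 / 4)) + \<alpha> * (a * (H * b / q * (g / g')))) / g
        = (m / (4 * q * g) + \<alpha> / g' / q) * (H * (b * a))" if "g > 0" for m a b q g g' :: real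
      using that by (simp add: add_divide_distrib distrib_left distrib_right mult_ac)
    show ?thesis
      unfolding K_def split add.commute[of \<beta> 1] using assms by (intro gen) (simp add: Gamma_real_pos)
  qed
  \<comment> \<open>The last-cell term still carries \<open>1 / (1 + \<beta>)\<close>; bounding this
    factor by 1 gives the stated constant.\<close>
  also have "\<dots> \<le> l1_error_const \<alpha> \<beta> 1 (Suc N) * (H * \<tau> powr (1 + \<beta> - \<alpha>))"
  proof (rule mult_right_mono)
    have "\<alpha> / Gamma (3 - \<alpha>) \<ge> 0"
      using assms by (simp add: Gamma_real_pos less_imp_le)
    then have "\<alpha> / Gamma (3 - \<alpha>) / (1 + \<beta>) \<le> \<alpha> / Gamma (3 - \<alpha>) / 1"
      using assms(3) by (intro divide_left_mono) auto
    then show "(1 - real (Suc N) powr (- \<alpha>)) / (4 * (\<beta> + 1) * Gamma (1 - \<alpha>)) + \<alpha> / Gamma (3 - \<alpha>) / (1 + \<beta>)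
        \<le> l1_error_const \<alpha> \<beta> 1 (Suc N)"
      by (simp add: l1_error_const_def)
  qed (use assms in simp)
  finally show ?thesis
    by (simp add: mult.assoc)
qed

theorem theorem1:
  fixes \<alpha> \<beta> \<tau> T :: real and k n :: nat and y :: "real \<Rightarrow> real"
  assumes "0 < \<alpha>" and "\<alpha> < 1" and "T > 0"
    and "k \<in> {0, 1}" and "0 \<le> \<beta>" and "\<beta> \<le> 1" and "real k + \<beta> > \<alpha>"
    and "y \<in> holder_space k \<beta> T"
    and "\<tau> > 0" and "n \<ge> 1" and "real n * \<tau> \<in> {0<..T}"
  shows "ereal \<bar>caputo \<alpha> y (real n * \<tau>) - l1_caputo \<alpha> \<tau> y n\<bar>
           \<le> ereal (l1_error_const \<alpha> \<beta> k n)
             * holder_seminorm \<beta> (real n * \<tau>) (iter_deriv_on k T y)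
             * ereal (\<tau> powr (real k + \<beta> - \<alpha>))"
proof -
  obtain N where n: "n = Suc N"
    using assms(10) by (cases n) auto
  define t where "t = real n * \<tau>"
  have t: "0 < t" "t \<le> T" "t = real (Suc N) * \<tau>"
    using assms(11) by (auto simp: t_def n)
  \<comment> \<open>The derivative stays the one relative to \<open>{0..T}\<close>; only the
    seminorm is restricted to the shorter interval.\<close>
  have "holder_seminorm \<beta> t (iter_deriv_on k T y) < \<infinity>"
    using assms(8) holder_seminorm_mono[OF t(2), of \<beta> "iter_deriv_on k T y"]
    by (auto simp: holder_space_def)
  then obtain H where H: "holder_seminorm \<beta> t (iter_deriv_on k T y) = ereal H" "0 \<le> H"
    and holder: "\<And>u v. \<lbrakk>u \<in> {0..t}; v \<in> {0..t}; u \<noteq> v\<rbrakk>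
        \<Longrightarrow> \<bar>iter_deriv_on k T y u - iter_deriv_on k T y v\<bar> \<le> H * \<bar>u - v\<bar> powr \<beta>"
    by (rule holder_seminormD[OF t(1)]) (rule that)
  have Ck: "y \<in> Ck_space k T"
    using assms(8) by (simp add: holder_space_def)
  have "\<bar>caputo \<alpha> y t - l1_caputo \<alpha> \<tau> y n\<bar> \<le> l1_error_const \<alpha> \<beta> k n * H * \<tau> powr (real k + \<beta> - \<alpha>)"
  proof (cases "k = 0")
    case True
    have cont: "continuous_on {0..t} y"
      using Ck True t(2) by (auto simp: Ck_space_def intro: continuous_on_subset)
    have "\<bar>y u - y v\<bar> \<le> H * \<bar>u - v\<bar> powr \<beta>" if "u \<in> {0..t}" "v \<in> {0..t}" for u v
      using holder[OF that] True by (cases "u = v") auto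
    from l1_truncation_holder[OF assms(1) _ assms(6,2,9) t(3) cont H(2) this] show ?thesis
      using True assms(7) by (simp add: n)
  next
    case False
    then have k: "k = 1"
      using assms(4) by simp
    have diff: "y differentiable_on {0..T}"
      using Ck by (auto simp: k Ck_space_def)
    have cont: "continuous_on {0..t} y"
      using differentiable_imp_continuous_on[OF diff] t(2) by (auto intro: continuous_on_subset)
    \<comment> \<open>At interior points the derivative relative to \<open>{0..T}\<close> is the
      ordinary two-sided one, as \<open>l1_truncation_holder_deriv\<close> requires.\<close>
    have deriv: "(y has_vector_derivative iter_deriv_on k T y u) (at u)" if "u \<in> {0<..<t}" for u
    proof -
      have "(y has_vector_derivative iter_deriv_on k T y u) (at u within {0..T})"
        using diff that t(2) by (auto simp: k differentiable_on_def simp flip: vector_derivative_works)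
      then show ?thesis
        using that t(2) by (simp add: at_within_Icc_at)
    qed
    from l1_truncation_holder_deriv[OF assms(1,2,5,9) t(3) cont H(2) deriv holder] show ?thesis
      by (simp add: n k)
  qed
  then show ?thesis
    unfolding t_def[symmetric] H(1) by simp
qed

end
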